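(* Assume $N\ge1$, $k\ge0$, $a>0$, $a+2\langle k\rangle+N>2$, and that at least one of the following holds: (i) $N=1$ and $a>0$; (ii) $a\in\{1,2\}$; (iii) $k\equiv0$ and $a=\frac2m$ for some $m\in\mathbb{N}$. If $f\in L^2(\mathbb{R}^N,\vartheta_{k,a}(x)dx)$ is nonzero, then $\mu_{k,a}(A_f)\cdot\mu_{k,a}(A_{\mathcal{F}_{k,a}f})\ge1$, where $A_f=\{x\in\mathbb{R}^N: f(x)\ne0\}$ and $A_{\mathcal{F}_{k,a}f}=\{\xi\in\mathbb{R}^N:\mathcal{F}_{k,a}f(\xi)\ne0\}$.
   Context: Let $\langle\cdot,\cdot\rangle$, $\|\cdot\|$ be the Euclidean inner product and norm on $\mathbb{R}^N$. Let $\mathcal{R}\subset\mathbb{R}^N\setminus\{0\}$ be a reduced root system with positive subsystem $\mathcal{R}^+$, let $r_\alpha(x)=x-2\frac{\langle\alpha,x\rangle}{\|\alpha\|^2}\alpha$, let $\mathfrak{C}$ be the finite group generated by the $r_\alpha$, and let $k:\mathcal{R}\to[0,\infty)$, $\alpha\mapsto k_\alpha$, be a $\mathfrak{C}$-invariant (multiplicity) function; $\langle k\rangle=\sum_{\alpha\in\mathcal{R}^+}k_\alpha$. For $a>0$ put $\vartheta_k(x)=\prod_{\alpha\in\mathcal{R}^+}|\langle\alpha,x\rangle|^{2k_\alpha}$, $\vartheta_{k,a}(x)=\|x\|^{a-2}\vartheta_k(x)$, $d\mu_{k,a}(x)=\vartheta_{k,a}(x)\,dx$, $L^p_{k,a}(\mathbb{R}^N)=L^p(\mathbb{R}^N,\mu_{k,a})$.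 The Dunkl Laplacian is $\Delta_kf(x)=\Delta f(x)+\sum_{\alpha\in\mathcal{R}^+}k_\alpha\bigl(\frac{2\langle\nabla f(x),\alpha\rangle}{\langle\alpha,x\rangle}-\|\alpha\|^2\frac{f(x)-f(r_\alpha x)}{\langle\alpha,x\rangle^2}\bigr)$. If $a+2\langle k\rangle+N>2$, the $(k,a)$-generalized Fourier transform is the unitary operator on $L^2_{k,a}(\mathbb{R}^N)$ given by $\mathcal{F}_{k,a}=\exp\bigl[\frac{i\pi}{2a}(2\langle k\rangle+N+a-2)\bigr]\exp\bigl[\frac{i\pi}{2a}(\|x\|^{2-a}\Delta_k-\|x\|^a)\bigr]$. Equivalently, it is the unitary operator determined by $\mathcal{F}_{k,a}\Phi_{\ell}(p,\cdot)=e^{-i\pi(\ell+m/a)}\Phi_\ell(p,\cdot)$ for $\ell,m\in\{0,1,2,\dots\}$ and $p$ a homogeneous polynomial of degree $m$ with $\Delta_kp=0$, where $\Phi_\ell(p,x)=p(x)L_\ell^{(\lambda_m)}(\frac2a\|x\|^a)e^{-\|x\|^a/a}$, $\lambda_m=\frac1a(2m+2\langle k\rangle+N-2)$, and $L_\ell^{(\lambda)}$ are Laguerre polynomials (these functions span a dense subspace). Standing normalization: $\mathcal{F}_{k,a}$ is unitary on $L^2_{k,a}(\mathbb{R}^N)$ and satisfies $\|\mathcal{F}_{k,a}f\|_\infty\le\|f\|_{L^1_{k,a}}$ for all $f\in L^1_{k,a}\cap L^2_{k,a}$. *)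

theory Defs
  imports "HOL-Analysis.Analysis" "HOL-Algebra.Bij" "HOL-Algebra.Generated_Groups"
begin

section \<open>Root systems and multiplicity functions\<close>

definition root_reflection :: "real ^ 'n \<Rightarrow> real ^ 'n \<Rightarrow> real ^ 'n" where
  "root_reflection \<alpha> x = x - (2 * (\<alpha> \<bullet> x) / (norm \<alpha>)\<^sup>2) *\<^sub>R \<alpha>"

text \<open>As usual in Dunkl theory, a root system need neither span the space nor be crystallographic.\<close>

definition reduced_root_system :: "(real ^ 'n) set \<Rightarrow> bool" where
  "reduced_root_system R \<longleftrightarrow>
     finite R \<and> 0 \<notin> R \<and>
     (\<forall>\<alpha>\<in>R. R \<inter> range (\<lambda>t. t *\<^sub>R \<alpha>) = {\<alpha>, - \<alpha>}) \<and>
     (\<forall>\<alpha>\<in>R. root_reflection \<alpha> ` R = R)"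

definition positive_subsystem :: "(real ^ 'n) set \<Rightarrow> (real ^ 'n) set \<Rightarrow> bool" where
  "positive_subsystem R Rp \<longleftrightarrow>
     (\<exists>\<beta>. (\<forall>\<alpha>\<in>R. \<alpha> \<bullet> \<beta> \<noteq> 0) \<and> Rp = {\<alpha> \<in> R. \<alpha> \<bullet> \<beta> > 0})"

definition reflection_group :: "(real ^ 'n) set \<Rightarrow> (real ^ 'n \<Rightarrow> real ^ 'n) set" where
  "reflection_group R = generate (BijGroup UNIV) (root_reflection ` R)"

text \<open>A multiplicity function is represented by a function on the whole space, of which only the
  values on the roots matter.\<close>

definition nonneg_multiplicity :: "(real ^ 'n) set \<Rightarrow> (real ^ 'n \<Rightarrow> real) \<Rightarrow> bool" where
  "nonneg_multiplicity R k \<longleftrightarrow>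
     (\<forall>\<alpha>\<in>R. 0 \<le> k \<alpha>) \<and> (\<forall>g\<in>reflection_group R. \<forall>\<alpha>\<in>R. k (g \<alpha>) = k \<alpha>)"

definition mult_index :: "(real ^ 'n) set \<Rightarrow> (real ^ 'n \<Rightarrow> real) \<Rightarrow> real" where
  "mult_index Rp k = (\<Sum>\<alpha>\<in>Rp. k \<alpha>)"

section \<open>The weighted measure and its square-integrable functions\<close>

text \<open>Since \<open>0 powr s = 0\<close> for every \<open>s\<close>, these weights can differ from the usual
  ones, but only at the origin and on the hyperplanes orthogonal to the roots, which
  are Lebesgue null sets.\<close>

definition dunkl_weight :: "(real ^ 'n) set \<Rightarrow> (real ^ 'n \<Rightarrow> real) \<Rightarrow> real ^ 'n \<Rightarrow> real" where
  "dunkl_weight Rp k x = (\<Prod>\<alpha>\<in>Rp. \<bar>\<alpha> \<bullet> x\<bar> powr (2 * k \<alpha>))"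

definition ka_weight :: "(real ^ 'n) set \<Rightarrow> (real ^ 'n \<Rightarrow> real) \<Rightarrow> real \<Rightarrow> real ^ 'n \<Rightarrow> real" where
  "ka_weight Rp k a x = norm x powr (a - 2) * dunkl_weight Rp k x"

definition ka_measure ::
  "(real ^ 'n) set \<Rightarrow> (real ^ 'n \<Rightarrow> real) \<Rightarrow> real \<Rightarrow> (real ^ 'n) measure" where
  "ka_measure Rp k a = density lebesgue (\<lambda>x. ennreal (ka_weight Rp k a x))"

text \<open>Elements of \<open>L\<^sup>2\<close> are represented by functions; almost everywhere
  equal functions are identified only through the AE statements below.\<close>

definition L2 :: "'a measure \<Rightarrow> ('a \<Rightarrow> complex) set" where
  "L2 M = {f \<in> borel_measurable M. integrable M (\<lambda>x. (cmod (f x))\<^sup>2)}"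

definition L2_inner :: "'a measure \<Rightarrow> ('a \<Rightarrow> complex) \<Rightarrow> ('a \<Rightarrow> complex) \<Rightarrow> complex" where
  "L2_inner M f g = (LINT x|M. f x * cnj (g x))"

definition unitary_on_L2 ::
  "'a measure \<Rightarrow> (('a \<Rightarrow> complex) \<Rightarrow> ('a \<Rightarrow> complex)) \<Rightarrow> bool" where
  "unitary_on_L2 M U \<longleftrightarrow>
     (\<forall>f\<in>L2 M. U f \<in> L2 M) \<and>
     (\<forall>f\<in>L2 M. \<forall>g\<in>L2 M. (AE x in M. f x = g x) \<longrightarrow> (AE x in M. U f x = U g x)) \<and>
     (\<forall>f\<in>L2 M. \<forall>g\<in>L2 M. AE x in M. U (\<lambda>y. f y + g y) x = U f x + U g x) \<and>
     (\<forall>c. \<forall>f\<in>L2 M. AE x in M. U (\<lambda>y. c * f y) x = c * U f x) \<and>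
     (\<forall>f\<in>L2 M. \<forall>g\<in>L2 M. L2_inner M (U f) (U g) = L2_inner M f g) \<and>
     (\<forall>g\<in>L2 M. \<exists>f\<in>L2 M. AE x in M. U f x = g x)"

section \<open>The generalized Fourier transform\<close>

definition laplacian :: "(real ^ 'n \<Rightarrow> complex) \<Rightarrow> real ^ 'n \<Rightarrow> complex" where
  "laplacian f x =
     (\<Sum>b\<in>Basis. frechet_derivative (\<lambda>y. frechet_derivative f (at y) b) (at x) b)"

text \<open>For a complex-valued function, the pairing of the gradient at \<open>x\<close> with \<open>\<alpha>\<close>
  is the derivative at \<open>x\<close> in the direction \<open>\<alpha>\<close>.\<close>

definition dunkl_laplacian ::
  "(real ^ 'n) set \<Rightarrow> (real ^ 'n \<Rightarrow> real) \<Rightarrow> (real ^ 'n \<Rightarrow> complex) \<Rightarrow> real ^ 'n \<Rightarrow> complex" where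
  "dunkl_laplacian Rp k f x = laplacian f x +
     (\<Sum>\<alpha>\<in>Rp. of_real (k \<alpha>) *
        (2 * frechet_derivative f (at x) \<alpha> / of_real (\<alpha> \<bullet> x)
         - of_real ((norm \<alpha>)\<^sup>2) * (f x - f (root_reflection \<alpha> x)) / of_real ((\<alpha> \<bullet> x)\<^sup>2)))"

definition homogeneous_polynomial :: "nat \<Rightarrow> (real ^ 'n \<Rightarrow> complex) \<Rightarrow> bool" where
  "homogeneous_polynomial m p \<longleftrightarrow>
     polynomial_function p \<and> (\<forall>t x. p (t *\<^sub>R x) = of_real (t ^ m) * p x)"

text \<open>The formula for the Dunkl Laplacian is meaningful only off the hyperplanes orthogonal to the
  roots. For a polynomial it agrees there with a polynomial, which is the intended value
  everywhere; as the complement of the hyperplanes is dense, it suffices to test vanishing there.\<close>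

definition dunkl_harmonic ::
  "(real ^ 'n) set \<Rightarrow> (real ^ 'n \<Rightarrow> real) \<Rightarrow> (real ^ 'n \<Rightarrow> complex) \<Rightarrow> bool" where
  "dunkl_harmonic Rp k p \<longleftrightarrow>
     (\<forall>x. (\<forall>\<alpha>\<in>Rp. \<alpha> \<bullet> x \<noteq> 0) \<longrightarrow> dunkl_laplacian Rp k p x = 0)"

definition laguerre :: "nat \<Rightarrow> real \<Rightarrow> real \<Rightarrow> real" where
  "laguerre l \<nu> t = (\<Sum>j\<le>l. (-1) ^ j * ((real l + \<nu>) gchoose (l - j)) * t ^ j / fact j)"

definition ka_eigenfunction ::
  "(real ^ 'n) set \<Rightarrow> (real ^ 'n \<Rightarrow> real) \<Rightarrow> real \<Rightarrow> nat \<Rightarrow> nat \<Rightarrow> (real ^ 'n \<Rightarrow> complex) \<Rightarrow>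
     real ^ 'n \<Rightarrow> complex" where
  "ka_eigenfunction Rp k a l m p x =
     (let \<nu> = (2 * real m + 2 * mult_index Rp k + real CARD('n) - 2) / a
      in p x * of_real (laguerre l \<nu> (2 / a * norm x powr a) * exp (- (norm x powr a) / a)))"

text \<open>The transform is the unitary operator with the prescribed eigenvalues on a total family. This
  predicate determines its values up to equality almost everywhere.\<close>

definition ka_fourier_transform ::
  "(real ^ 'n) set \<Rightarrow> (real ^ 'n \<Rightarrow> real) \<Rightarrow> real \<Rightarrow>
     ((real ^ 'n \<Rightarrow> complex) \<Rightarrow> (real ^ 'n \<Rightarrow> complex)) \<Rightarrow> bool" where
  "ka_fourier_transform Rp k a F \<longleftrightarrow>
     unitary_on_L2 (ka_measure Rp k a) F \<and>
     (\<forall>l m p. homogeneous_polynomial m p \<and> dunkl_harmonic Rp k p \<longrightarrow>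
        (AE x in ka_measure Rp k a.
           F (ka_eigenfunction Rp k a l m p) x =
             exp (- \<i> * of_real (pi * (real l + real m / a))) * ka_eigenfunction Rp k a l m p x))"

end

theory Submission
  imports Defs
begin

text \<open>By Cauchy--Schwarz, \<open>(\<integral>\<bar>f\<bar>)\<^sup>2 \<le> \<mu>(A\<^sub>f) \<integral>\<bar>f\<bar>\<^sup>2\<close>. If \<open>g\<close> is bounded by \<open>\<integral>\<bar>f\<bar>\<close>
  and has the same \<open>L\<^sup>2\<close> norm as \<open>f\<close>, then \<open>\<integral>\<bar>f\<bar>\<^sup>2 = \<integral>\<bar>g\<bar>\<^sup>2 \<le> \<mu>(A\<^sub>g) (\<integral>\<bar>f\<bar>)\<^sup>2\<close>, and the
  two estimates combine.\<close>

lemma nn_integral_norm_squared_le_support: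
  fixes f :: "'a \<Rightarrow> 'b::{real_normed_vector, second_countable_topology}"
  assumes [measurable]: "f \<in> borel_measurable M"
  shows "(\<integral>\<^sup>+x. norm (f x) \<partial>M)\<^sup>2
    \<le> (\<integral>\<^sup>+x. (norm (f x))\<^sup>2 \<partial>M) * emeasure M {x \<in> space M. f x \<noteq> 0}"
proof -
  let ?A = "{x \<in> space M. f x \<noteq> 0}"
  \<comment> \<open>The indicator of the support leaves the integrand unchanged and serves as the
    second factor in Cauchy-Schwarz. It equals its own square, so that factor integrates to the
    measure of \<open>?A\<close>.\<close>
  have "(\<integral>\<^sup>+x. norm (f x) \<partial>M) = (\<integral>\<^sup>+x. ennreal (norm (f x)) * indicator ?A x \<partial>M)"
    by (intro nn_integral_cong) (auto split: split_indicator)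
  also have "(\<dots>)\<^sup>2 \<le> (\<integral>\<^sup>+x. ennreal (norm (f x)) ^ 2 \<partial>M) * (\<integral>\<^sup>+x. indicator ?A x ^ 2 \<partial>M)"
    by (rule Cauchy_Schwarz_nn_integral) measurable
  also have "(\<integral>\<^sup>+x. indicator ?A x ^ 2 \<partial>M) = (\<integral>\<^sup>+x. indicator ?A x \<partial>M)"
    by (intro nn_integral_cong) (auto split: split_indicator)
  finally show ?thesis
    by (simp add: ennreal_power)
qed

text \<open>The sup bound is conditional because the normalization of the transform only covers
  functions that are both integrable and square-integrable. Integrability of \<open>f\<close> is
  derived in the case where its support has finite measure.\<close>

lemma support_product_ge_1:
  fixes f :: "'a \<Rightarrow> 'b::{banach, second_countable_topology}"
    and g :: "'a \<Rightarrow> 'c::{real_normed_vector, second_countable_topology}"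
  assumes [measurable]: "f \<in> borel_measurable M" "g \<in> borel_measurable M"
    and f_finite: "(\<integral>\<^sup>+x. (norm (f x))\<^sup>2 \<partial>M) < \<infinity>"
    and same_norm: "(\<integral>\<^sup>+x. (norm (g x))\<^sup>2 \<partial>M) = (\<integral>\<^sup>+x. (norm (f x))\<^sup>2 \<partial>M)"
    and f_nonzero: "\<not> (AE x in M. f x = 0)"
    and bound: "integrable M f \<Longrightarrow> AE x in M. norm (g x) \<le> (LINT x|M. norm (f x))"
  shows "1 \<le> emeasure M {x \<in> space M. f x \<noteq> 0} * emeasure M {x \<in> space M. g x \<noteq> 0}"
proof -
  let ?Af = "{x \<in> space M. f x \<noteq> 0}" and ?Ag = "{x \<in> space M. g x \<noteq> 0}"
  define S where "S = (\<integral>\<^sup>+x. (norm (f x))\<^sup>2 \<partial>M)"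
  have S: "S \<noteq> 0" "S < \<infinity>" "S = (\<integral>\<^sup>+x. (norm (g x))\<^sup>2 \<partial>M)"
    using f_nonzero f_finite same_norm by (auto simp: S_def nn_integral_0_iff_AE)
  show ?thesis
  proof (cases "emeasure M ?Af = \<infinity>")
    case True
    \<comment> \<open>Since \<open>\<infinity> * 0 = 0\<close> in \<open>ennreal\<close>, an
      infinite first factor is not enough: the support of \<open>g\<close> must not be null, which
      follows from its nonzero norm.\<close>
    have "\<not> (AE x in M. g x = 0)"
      using S by (auto simp: nn_integral_0_iff_AE)
    then have "emeasure M ?Ag \<noteq> 0"
      by (subst (asm) AE_iff_measurable[OF _ refl]) auto
    with True show ?thesis
      by (simp add: ennreal_top_mult)
  next
    case False
    define I where "I = (\<integral>\<^sup>+x. norm (f x) \<partial>M)"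
    have I: "I\<^sup>2 \<le> S * emeasure M ?Af"
      unfolding I_def S_def by (rule nn_integral_norm_squared_le_support) fact
    also have "\<dots> < \<infinity>"
      using S False by (simp add: ennreal_mult_less_top top.not_eq_extremum)
    finally have "I < \<infinity>"
      by (simp add: power_less_top_ennreal)
    \<comment> \<open>Square-integrability together with a support of finite measure gives
      integrability, which makes \<open>bound\<close> available.\<close>
    then have int: "integrable M f"
      by (simp add: integrable_iff_bounded I_def)
    \<comment> \<open>On \<open>?Ag\<close> the integrand is at most the square of the sup bound;
      elsewhere it vanishes.\<close>
    have "S \<le> (\<integral>\<^sup>+x. I\<^sup>2 * indicator ?Ag x \<partial>M)"
      unfolding S(3)
    proof (rule nn_integral_mono_AE)
      have I_eq: "I = ennreal (LINT x|M. norm (f x))"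
        unfolding I_def using int by (intro nn_integral_eq_integral) auto
      show "AE x in M. ennreal ((norm (g x))\<^sup>2) \<le> I\<^sup>2 * indicator ?Ag x"
        using bound[OF int] AE_space
        by eventually_elim (auto split: split_indicator simp: I_eq ennreal_power power_mono)
    qed
    also have "\<dots> = I\<^sup>2 * emeasure M ?Ag"
      by (simp add: nn_integral_cmult_indicator)
    also have "\<dots> \<le> S * emeasure M ?Af * emeasure M ?Ag"
      by (intro mult_right_mono I) simp
    \<comment> \<open>Cancelling \<open>S\<close> in \<open>ennreal\<close> requires it to be both
      nonzero and finite.\<close>
    finally have "S * 1 \<le> S * (emeasure M ?Af * emeasure M ?Ag)"
      by (simp add: mult.assoc)
    then show ?thesis
      using S by (subst (asm) ennreal_mult_le_mult_iff) auto
  qed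
qed

lemma L2_inner_self: "L2_inner M f f = of_real (LINT x|M. (cmod (f x))\<^sup>2)"
  by (simp add: L2_inner_def complex_norm_square[symmetric] flip: of_real_power)

text \<open>Membership in \<open>L2\<close> supplies integrability; without it the Bochner integral
  would default to 0 and the two sides could differ.\<close>

lemma nn_integral_L2:
  assumes "f \<in> L2 M"
  shows "(\<integral>\<^sup>+x. (cmod (f x))\<^sup>2 \<partial>M) = ennreal (LINT x|M. (cmod (f x))\<^sup>2)"
  using assms by (intro nn_integral_eq_integral) (auto simp: L2_def)

theorem proposition9p2:
  fixes R Rp :: "(real ^ 'n) set"
    and k :: "real ^ 'n \<Rightarrow> real"
    and a :: real
    and F :: "(real ^ 'n \<Rightarrow> complex) \<Rightarrow> (real ^ 'n \<Rightarrow> complex)"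
    and f :: "real ^ 'n \<Rightarrow> complex"
  assumes root_system: "reduced_root_system R" "positive_subsystem R Rp"
    and multiplicity: "nonneg_multiplicity R k"
    and a_pos: "a > 0"
    and index: "a + 2 * mult_index Rp k + real CARD('n) > 2"
    and cases: "CARD('n) = 1 \<or> a \<in> {1, 2} \<or>
                ((\<forall>\<alpha>\<in>R. k \<alpha> = 0) \<and> (\<exists>m::nat. m \<ge> 1 \<and> a = 2 / real m))"
    and transform: "ka_fourier_transform Rp k a F"
    and normalization: "\<And>g. g \<in> L2 (ka_measure Rp k a) \<Longrightarrow> integrable (ka_measure Rp k a) g \<Longrightarrow>
          AE \<xi> in ka_measure Rp k a. cmod (F g \<xi>) \<le> (LINT x|ka_measure Rp k a. cmod (g x))"
    and f_L2: "f \<in> L2 (ka_measure Rp k a)"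
    and f_nonzero: "\<not> (AE x in ka_measure Rp k a. f x = 0)"
  shows "emeasure (ka_measure Rp k a) {x. f x \<noteq> 0} *
         emeasure (ka_measure Rp k a) {\<xi>. F f \<xi> \<noteq> 0} \<ge> 1"
proof -
  let ?M = "ka_measure Rp k a"
  have unitary: "unitary_on_L2 ?M F"
    using transform by (simp add: ka_fourier_transform_def)
  then have Ff: "F f \<in> L2 ?M" and "L2_inner ?M (F f) (F f) = L2_inner ?M f f"
    using f_L2 by (auto simp: unitary_on_L2_def)
  \<comment> \<open>Preservation of the inner product, taken on the diagonal, is the Plancherel
    identity.\<close>
  then have "(LINT x|?M. (cmod (F f x))\<^sup>2) = (LINT x|?M. (cmod (f x))\<^sup>2)"
    unfolding L2_inner_self of_real_eq_iff by simp
  then have "(\<integral>\<^sup>+x. (cmod (F f x))\<^sup>2 \<partial>?M) = (\<integral>\<^sup>+x. (cmod (f x))\<^sup>2 \<partial>?M)"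
    using f_L2 Ff by (simp add: nn_integral_L2)
  moreover have "f \<in> borel_measurable ?M" "F f \<in> borel_measurable ?M"
    using f_L2 Ff by (auto simp: L2_def)
  moreover have "(\<integral>\<^sup>+x. (cmod (f x))\<^sup>2 \<partial>?M) < \<infinity>"
    using f_L2 by (simp add: nn_integral_L2)
  ultimately have "1 \<le> emeasure ?M {x \<in> space ?M. f x \<noteq> 0} * emeasure ?M {x \<in> space ?M. F f x \<noteq> 0}"
    using f_nonzero normalization[OF f_L2] by (intro support_product_ge_1)
  then show ?thesis
    \<comment> \<open>A density of \<open>lebesgue\<close> has the whole space as its
      \<open>space\<close>, so the restriction to \<open>space ?M\<close> disappears.\<close>
    by (simp add: ka_measure_def)
qed

end
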